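(* Let $X$ be a normed space, $Y$ a topological space carrying a vector space structure, and $\pi:X\to Y$ a linear quotient map. Let $\psi:Y\to X$ be a section of $\pi$ and let $\hat x\in\psi(Y)$. Then the set $I_{\psi,\hat x}$ of all sections of $\pi$ that are intrinsically $(L,M)$-quasi-isometric with respect to $\psi$ at the point $\hat x$ for some $L\ge1$ and $M\ge0$ is a convex set.
   Context: A quotient map is a continuous, open and surjective map. A section of $\pi$ is a map $\phi:Y\to X$ with $\pi\circ\phi=\mathrm{id}_Y$. The distance on $X$ is $d(x,x')=\|x-x'\|$. Convexity refers to pointwise convex combinations of maps $Y\to X$. Given sections $\phi,\psi$ of $\pi$ and $\hat x\in X$, $\phi$ is intrinsically $(L,M)$-quasi-isometric with respect to $\psi$ at $\hat x$ if $\hat x\in\psi(Y)\cap\phi(Y)$ and $\phi(Y)\cap C^{\psi}_{\hat x,L}=\emptyset$, where $C^{\psi}_{\hat x,L}:=\{x\in X: d(x,\psi(\pi(x)))>L\,d(\hat x,\psi(\pi(x)))+M\}$. Equivalently, there is $\hat y\in Y$ with $\hat x=\phi(\hat y)=\psi(\hat y)$ and $$d(\phi(y),\psi(y))\le L\,d(\psi(\hat y),\psi(y))+M\quad\text{for all } y\in Y.$$ $I_{\psi,\hat x}:=\{\phi:Y\to X\text{ a section of }\pi:\ \phi$ is intrinsically $(L,M)$-quasi-isometric with respect to $\psi$ at $\hat x$ for some $L\ge1$, $M\ge0\}$. *)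

theory Defs
  imports "HOL-Analysis.Analysis" "HOL-Library.Function_Algebras"
begin

text \<open>Maps into a real vector space form a real vector space pointwise, so that the library's
  \<^term>\<open>convex\<close> applies to sets of maps and refers to pointwise convex combinations.\<close>

instantiation "fun" :: (type, real_vector) real_vector
begin

definition scaleR_fun :: "real \<Rightarrow> ('a \<Rightarrow> 'b) \<Rightarrow> 'a \<Rightarrow> 'b"
  where "scaleR_fun r f = (\<lambda>x. r *\<^sub>R f x)"

instance
  by standard
    (simp_all add: scaleR_fun_def plus_fun_def fun_eq_iff scaleR_add_right scaleR_add_left)

end

text \<open>This is stronger than the library's \<^const>\<open>quotient_map\<close>, which does not require openness.\<close>

definition open_quotient_map :: "('a::topological_space \<Rightarrow> 'b::topological_space) \<Rightarrow> bool"
  where "open_quotient_map \<pi> \<longleftrightarrow>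
    continuous_on UNIV \<pi> \<and> open_map euclidean euclidean \<pi> \<and> surj \<pi>"

text \<open>Sections are not required to be continuous.\<close>

definition is_section :: "('a \<Rightarrow> 'b) \<Rightarrow> ('b \<Rightarrow> 'a) \<Rightarrow> bool"
  where "is_section \<pi> \<phi> \<longleftrightarrow> \<pi> \<circ> \<phi> = id"

definition intrinsic_cone ::
    "('a::metric_space \<Rightarrow> 'b) \<Rightarrow> ('b \<Rightarrow> 'a) \<Rightarrow> 'a \<Rightarrow> real \<Rightarrow> real \<Rightarrow> 'a set"
  where "intrinsic_cone \<pi> \<psi> xhat L M =
    {x. dist x (\<psi> (\<pi> x)) > L * dist xhat (\<psi> (\<pi> x)) + M}"

definition intrinsically_quasi_isometric ::
    "('a::metric_space \<Rightarrow> 'b) \<Rightarrow> real \<Rightarrow> real \<Rightarrow> ('b \<Rightarrow> 'a) \<Rightarrow> ('b \<Rightarrow> 'a) \<Rightarrow> 'a \<Rightarrow> bool"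
  where "intrinsically_quasi_isometric \<pi> L M \<phi> \<psi> xhat \<longleftrightarrow>
    xhat \<in> range \<psi> \<inter> range \<phi> \<and> range \<phi> \<inter> intrinsic_cone \<pi> \<psi> xhat L M = {}"

definition intrinsic_sections ::
    "('a::metric_space \<Rightarrow> 'b) \<Rightarrow> ('b \<Rightarrow> 'a) \<Rightarrow> 'a \<Rightarrow> ('b \<Rightarrow> 'a) set"
  where "intrinsic_sections \<pi> \<psi> xhat =
    {\<phi>. is_section \<pi> \<phi> \<and>
         (\<exists>L M. L \<ge> 1 \<and> M \<ge> 0 \<and> intrinsically_quasi_isometric \<pi> L M \<phi> \<psi> xhat)}"

end

theory Submission
  imports Defs
begin

text \<open>Write \<open>yhat = \<pi> xhat\<close>. For a section \<open>\<phi>\<close>, being intrinsically \<open>(L, M)\<close>-quasi-isometric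
  with respect to \<open>\<psi>\<close> at \<open>xhat\<close> means that \<open>\<phi>\<close> and \<open>\<psi>\<close> both send \<open>yhat\<close> to \<open>xhat\<close> and that
  \<open>dist (\<phi> y) (\<psi> y) \<le> L * dist xhat (\<psi> y) + M\<close> for all \<open>y\<close>. Each of these conditions survives
  convex combinations: linearity of \<open>\<pi>\<close> keeps the combination a section, and convexity of the
  distance to \<open>\<psi> y\<close> gives the bound for the combination
  \<open>u *\<^sub>R \<phi>\<^sub>1 + v *\<^sub>R \<phi>\<^sub>2\<close> with the constants \<open>u * L\<^sub>1 + v * L\<^sub>2 \<ge> 1\<close> and
  \<open>u * M\<^sub>1 + v * M\<^sub>2 \<ge> 0\<close>.\<close>

lemma is_section_apply: "is_section \<pi> \<phi> \<Longrightarrow> \<pi> (\<phi> y) = y"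
  by (metis comp_apply id_apply is_section_def)

lemma mem_range_section_iff:
  assumes "is_section \<pi> \<phi>"
  shows "x \<in> range \<phi> \<longleftrightarrow> \<phi> (\<pi> x) = x"
  using is_section_apply[OF assms] by (metis imageE rangeI)

lemma intrinsically_quasi_isometric_iff:
  assumes "is_section \<pi> \<phi>" and "is_section \<pi> \<psi>"
  shows "intrinsically_quasi_isometric \<pi> L M \<phi> \<psi> xhat \<longleftrightarrow>
    \<psi> (\<pi> xhat) = xhat \<and> \<phi> (\<pi> xhat) = xhat \<and>
    (\<forall>y. dist (\<phi> y) (\<psi> y) \<le> L * dist xhat (\<psi> y) + M)"
proof -
  have "range \<phi> \<inter> intrinsic_cone \<pi> \<psi> xhat L M = {} \<longleftrightarrow>
      (\<forall>y. dist (\<phi> y) (\<psi> y) \<le> L * dist xhat (\<psi> y) + M)"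
  proof -
    have "range \<phi> \<inter> intrinsic_cone \<pi> \<psi> xhat L M = {} \<longleftrightarrow>
        (\<forall>y. \<phi> y \<notin> intrinsic_cone \<pi> \<psi> xhat L M)"
      by blast
    then show ?thesis
      by (simp add: intrinsic_cone_def is_section_apply[OF assms(1)] not_less)
  qed
  then show ?thesis
    unfolding intrinsically_quasi_isometric_def Int_iff
      mem_range_section_iff[OF assms(1)] mem_range_section_iff[OF assms(2)]
    by blast
qed

lemma convex_combination_apply:
  fixes f g :: "'b \<Rightarrow> 'a::real_vector"
  shows "(u *\<^sub>R f + v *\<^sub>R g) y = u *\<^sub>R f y + v *\<^sub>R g y"
  by (simp add: scaleR_fun_def)

lemma is_section_convex_combination:
  assumes "linear \<pi>" and "is_section \<pi> \<phi>" and "is_section \<pi> \<psi>" and "u + v = 1"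
  shows "is_section \<pi> (u *\<^sub>R \<phi> + v *\<^sub>R \<psi>)"
  using assms
  by (simp add: is_section_def fun_eq_iff scaleR_fun_def linear_add linear_scale
      flip: scaleR_add_left)

lemma dist_convex_combination_le:
  fixes a b c :: "'a::real_normed_vector"
  assumes "u \<ge> 0" and "v \<ge> 0" and "u + v = 1"
  shows "dist (u *\<^sub>R a + v *\<^sub>R b) c \<le> u * dist a c + v * dist b c"
proof -
  have "c = u *\<^sub>R c + v *\<^sub>R c"
    using assms(3) by (simp flip: scaleR_add_left)
  then have "dist (u *\<^sub>R a + v *\<^sub>R b) c = dist (u *\<^sub>R a + v *\<^sub>R b) (u *\<^sub>R c + v *\<^sub>R c)"
    by simp
  also have "\<dots> \<le> dist (u *\<^sub>R a) (u *\<^sub>R c) + dist (v *\<^sub>R b) (v *\<^sub>R c)"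
    by (rule dist_triangle_add)
  also have "\<dots> = u * dist a c + v * dist b c"
    using assms(1,2) by (simp add: dist_norm flip: scaleR_diff_right)
  finally show ?thesis .
qed

theorem proposition2p8:
  fixes \<pi> :: "'a::real_normed_vector \<Rightarrow> 'b::{real_vector, topological_space}"
    and \<psi> :: "'b \<Rightarrow> 'a"
    and xhat :: 'a
  assumes "linear \<pi>"
    and "open_quotient_map \<pi>"
    and "is_section \<pi> \<psi>"
    and "xhat \<in> range \<psi>"
  shows "convex (intrinsic_sections \<pi> \<psi> xhat)"
proof (rule convexI)
  fix f g :: "'b \<Rightarrow> 'a" and u v :: real
  assume f_in: "f \<in> intrinsic_sections \<pi> \<psi> xhat" and g_in: "g \<in> intrinsic_sections \<pi> \<psi> xhat"
    and u: "0 \<le> u" and v: "0 \<le> v" and uv: "u + v = 1"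
  let ?h = "u *\<^sub>R f + v *\<^sub>R g"
  from f_in obtain L1 M1 where f: "is_section \<pi> f" and L1: "L1 \<ge> 1" and M1: "M1 \<ge> 0"
    and "intrinsically_quasi_isometric \<pi> L1 M1 f \<psi> xhat"
    unfolding intrinsic_sections_def by blast
  then have psi_hat: "\<psi> (\<pi> xhat) = xhat" and f_hat: "f (\<pi> xhat) = xhat"
    and f_le: "dist (f y) (\<psi> y) \<le> L1 * dist xhat (\<psi> y) + M1" for y
    by (simp_all add: intrinsically_quasi_isometric_iff[OF _ assms(3)])
  from g_in obtain L2 M2 where g: "is_section \<pi> g" and L2: "L2 \<ge> 1" and M2: "M2 \<ge> 0"
    and "intrinsically_quasi_isometric \<pi> L2 M2 g \<psi> xhat"
    unfolding intrinsic_sections_def by blast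
  then have g_hat: "g (\<pi> xhat) = xhat"
    and g_le: "dist (g y) (\<psi> y) \<le> L2 * dist xhat (\<psi> y) + M2" for y
    by (simp_all add: intrinsically_quasi_isometric_iff[OF _ assms(3)])
  let ?L = "u * L1 + v * L2" and ?M = "u * M1 + v * M2"
  have h: "is_section \<pi> ?h"
    by (rule is_section_convex_combination[OF assms(1) f g uv])
  have h_hat: "?h (\<pi> xhat) = xhat"
    using uv by (simp add: convex_combination_apply f_hat g_hat del: plus_fun_apply
        flip: scaleR_add_left)
  have h_le: "dist (?h y) (\<psi> y) \<le> ?L * dist xhat (\<psi> y) + ?M" for y
  proof -
    have "dist (?h y) (\<psi> y) \<le> u * dist (f y) (\<psi> y) + v * dist (g y) (\<psi> y)"
      unfolding convex_combination_apply by (rule dist_convex_combination_le[OF u v uv])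
    also have "\<dots> \<le> u * (L1 * dist xhat (\<psi> y) + M1) + v * (L2 * dist xhat (\<psi> y) + M2)"
      by (intro add_mono mult_left_mono f_le g_le u v)
    also have "\<dots> = ?L * dist xhat (\<psi> y) + ?M"
      by (simp add: algebra_simps)
    finally show ?thesis .
  qed
  have "u * 1 + v * 1 \<le> ?L"
    by (intro add_mono mult_left_mono L1 L2 u v)
  then have "?L \<ge> 1"
    using uv by simp
  moreover have "?M \<ge> 0"
    using u v M1 M2 by simp
  moreover have "intrinsically_quasi_isometric \<pi> ?L ?M ?h \<psi> xhat"
    unfolding intrinsically_quasi_isometric_iff[OF h assms(3)]
    using psi_hat h_hat h_le by blast
  ultimately show "?h \<in> intrinsic_sections \<pi> \<psi> xhat"
    unfolding intrinsic_sections_def using h by blast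
qed

end
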